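(* Let $T$ be a complete first-order theory with infinite models. If $T$ has $\mathbf{c}$-TP then $T$ is unstable. Moreover, if a partitioned formula $\varphi(x,y)$ has $\mathbf{c}$-TP, then $\varphi(x,y)$ is an unstable formula.
   Context: For a cardinal $\kappa\ge 2$, the colored linear order $\mathbf{c}=\mathbf{c}_\kappa$ is the Fraïssé limit of the class of finite structures in the language $\{<,(c_\alpha)_{\alpha<\kappa}\}$ in which $<$ is a linear order and the unary predicates $c_\alpha$ ("colors") partition the domain; every color is dense. (When $\kappa$ is unspecified, $\mathbf{c}$ is $\mathbf{c}_\kappa$ for arbitrary $\kappa\ge2$.) $\mathbf{c}^{<\omega}$ is the tree of functions from finite initial segments of $\omega$ to $\mathbf{c}$, ordered by extension, with root $\emptyset$; immediate successors of $\eta$ are $\eta^\frown i$, $i\in\mathbf{c}$; $\mathbf{c}^\omega$ is the set of branches. Given a complete quantifier-free $n$-type $q$ in the language of $\mathbf{c}$, a family $\{\varphi(x,a_i):i\in\mathbf{c}\}$ is $q$-inconsistent if whenever $(i_1,\dots,i_n)\models q$, $\{\varphi(x,a_{i_1}),\dots,\varphi(x,a_{i_n})\}$ is inconsistent. $\varphi(x,y)$ has $\mathbf{c}$-TP if there are tuples $(a_\eta)_{\eta\in\mathbf{c}^{<\omega}}$ in the monster model and a complete quantifier-free type $q$ in the language of $\mathbf{c}$ such that (1) for every $\beta\in\mathbf{c}^\omega$, $\{\varphi(x,a_{\beta|_i}):i<\omega\}$ is consistent, and (2) for every $\eta$, $\{\varphi(x,a_{\eta^\frown i}):i\in\mathbf{c}\}$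 is $q$-inconsistent. A theory has $\mathbf{c}$-TP if some formula does. *)

theory Defs
  imports Main "HOL-Library.Countable_Set"
begin

unbundle cardinal_syntax

section \<open>First-order logic\<close>

record ('f, 'r) lang =
  fun_symbols :: "'f set"
  rel_symbols :: "'r set"
  fun_arity :: "'f \<Rightarrow> nat"
  rel_arity :: "'r \<Rightarrow> nat"

datatype 'f tm = Var nat | Fun 'f "'f tm list"

datatype ('f, 'r) fm =
    Eq "'f tm" "'f tm"
  | Rel 'r "'f tm list"
  | Neg "('f, 'r) fm"
  | Conj "('f, 'r) fm" "('f, 'r) fm"
  | Ex nat "('f, 'r) fm"

primrec vars_tm :: "'f tm \<Rightarrow> nat set" where
  "vars_tm (Var v) = {v}"
| "vars_tm (Fun f ts) = \<Union> (set (map vars_tm ts))"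

primrec is_term :: "('f, 'r) lang \<Rightarrow> 'f tm \<Rightarrow> bool" where
  "is_term L (Var v) \<longleftrightarrow> True"
| "is_term L (Fun f ts) \<longleftrightarrow>
     f \<in> fun_symbols L \<and> length ts = fun_arity L f \<and> list_all (is_term L) ts"

primrec free_vars :: "('f, 'r) fm \<Rightarrow> nat set" where
  "free_vars (Eq s t) = vars_tm s \<union> vars_tm t"
| "free_vars (Rel r ts) = \<Union> (set (map vars_tm ts))"
| "free_vars (Neg p) = free_vars p"
| "free_vars (Conj p q) = free_vars p \<union> free_vars q"
| "free_vars (Ex v p) = free_vars p - {v}"

primrec is_formula :: "('f, 'r) lang \<Rightarrow> ('f, 'r) fm \<Rightarrow> bool" where
  "is_formula L (Eq s t) \<longleftrightarrow> is_term L s \<and> is_term L t"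
| "is_formula L (Rel r ts) \<longleftrightarrow>
     r \<in> rel_symbols L \<and> length ts = rel_arity L r \<and> list_all (is_term L) ts"
| "is_formula L (Neg p) \<longleftrightarrow> is_formula L p"
| "is_formula L (Conj p q) \<longleftrightarrow> is_formula L p \<and> is_formula L q"
| "is_formula L (Ex v p) \<longleftrightarrow> is_formula L p"

primrec quantifier_free :: "('f, 'r) fm \<Rightarrow> bool" where
  "quantifier_free (Eq s t) \<longleftrightarrow> True"
| "quantifier_free (Rel r ts) \<longleftrightarrow> True"
| "quantifier_free (Neg p) \<longleftrightarrow> quantifier_free p"
| "quantifier_free (Conj p q) \<longleftrightarrow> quantifier_free p \<and> quantifier_free q"
| "quantifier_free (Ex v p) \<longleftrightarrow> False"

definition sentences :: "('f, 'r) lang \<Rightarrow> ('f, 'r) fm set" where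
  "sentences L = {p. is_formula L p \<and> free_vars p = {}}"

record ('f, 'r, 'm) struct =
  univ :: "'m set"
  fun_interp :: "'f \<Rightarrow> 'm list \<Rightarrow> 'm"
  rel_interp :: "'r \<Rightarrow> 'm list \<Rightarrow> bool"

definition tuples :: "('f, 'r, 'm) struct \<Rightarrow> nat \<Rightarrow> 'm list set" where
  "tuples M n = {as. length as = n \<and> set as \<subseteq> univ M}"

definition is_structure :: "('f, 'r) lang \<Rightarrow> ('f, 'r, 'm) struct \<Rightarrow> bool" where
  "is_structure L M \<longleftrightarrow> univ M \<noteq> {} \<and>
     (\<forall>f \<in> fun_symbols L. \<forall>as \<in> tuples M (fun_arity L f). fun_interp M f as \<in> univ M)"

primrec eval_tm :: "('f, 'r, 'm) struct \<Rightarrow> (nat \<Rightarrow> 'm) \<Rightarrow> 'f tm \<Rightarrow> 'm" where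
  "eval_tm M e (Var v) = e v"
| "eval_tm M e (Fun f ts) = fun_interp M f (map (eval_tm M e) ts)"

primrec sat :: "('f, 'r, 'm) struct \<Rightarrow> (nat \<Rightarrow> 'm) \<Rightarrow> ('f, 'r) fm \<Rightarrow> bool" where
  "sat M e (Eq s t) \<longleftrightarrow> eval_tm M e s = eval_tm M e t"
| "sat M e (Rel r ts) \<longleftrightarrow> rel_interp M r (map (eval_tm M e) ts)"
| "sat M e (Neg p) \<longleftrightarrow> \<not> sat M e p"
| "sat M e (Conj p q) \<longleftrightarrow> sat M e p \<and> sat M e q"
| "sat M e (Ex v p) \<longleftrightarrow> (\<exists>d \<in> univ M. sat M (e(v := d)) p)"

definition true_in :: "('f, 'r, 'm) struct \<Rightarrow> ('f, 'r) fm \<Rightarrow> bool" where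
  "true_in M p \<longleftrightarrow> (\<forall>e. range e \<subseteq> univ M \<longrightarrow> sat M e p)"

definition is_model ::
  "('f, 'r) lang \<Rightarrow> ('f, 'r) fm set \<Rightarrow> ('f, 'r, 'm) struct \<Rightarrow> bool" where
  "is_model L T M \<longleftrightarrow> is_structure L M \<and> (\<forall>p \<in> T. true_in M p)"

text \<open>
  HOL cannot quantify over all types inside a definition. In the next three definitions models
  therefore range over the structures whose universe is a subset of the type of formulas.
  This type is infinite and at least as large as the set of L-formulas, so by the downward
  Loewenheim-Skolem theorem every model (every infinite model) of \<open>T\<close> is elementarily
  equivalent to a model (an infinite model) of this kind, and nothing is lost.
\<close>

definition entails :: "('f, 'r) lang \<Rightarrow> ('f, 'r) fm set \<Rightarrow> ('f, 'r) fm \<Rightarrow> bool" where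
  "entails L T p \<longleftrightarrow>
     (\<forall>N :: ('f, 'r, ('f, 'r) fm) struct. is_model L T N \<longrightarrow> true_in N p)"

definition complete_theory :: "('f, 'r) lang \<Rightarrow> ('f, 'r) fm set \<Rightarrow> bool" where
  "complete_theory L T \<longleftrightarrow> T \<subseteq> sentences L \<and>
     (\<exists>N :: ('f, 'r, ('f, 'r) fm) struct. is_model L T N) \<and>
     (\<forall>p \<in> sentences L. entails L T p \<or> entails L T (Neg p))"

definition has_infinite_model :: "('f, 'r) lang \<Rightarrow> ('f, 'r) fm set \<Rightarrow> bool" where
  "has_infinite_model L T \<longleftrightarrow>
     (\<exists>N :: ('f, 'r, ('f, 'r) fm) struct. is_model L T N \<and> infinite (univ N))"


section \<open>Instances of formulas and the monster model\<close>

definition assign :: "(nat \<Rightarrow> 'm) \<Rightarrow> nat list \<Rightarrow> 'm list \<Rightarrow> nat \<Rightarrow> 'm" where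
  "assign e xs as v = (case map_of (zip xs as) v of Some d \<Rightarrow> d | None \<Rightarrow> e v)"

text \<open>
  A formula with parameters, in the variables \<open>xs\<close>, is a pair \<open>(p, s)\<close>: the free variables
  of \<open>p\<close> outside \<open>xs\<close> stand for the parameters that \<open>s\<close> gives them.
\<close>

type_synonym ('f, 'r, 'm) pfm = "('f, 'r) fm \<times> (nat \<Rightarrow> 'm)"

definition is_pformula ::
  "('f, 'r) lang \<Rightarrow> 'm set \<Rightarrow> nat list \<Rightarrow> ('f, 'r, 'm) pfm \<Rightarrow> bool" where
  "is_pformula L A xs = (\<lambda>(p, s). is_formula L p \<and> s ` (free_vars p - set xs) \<subseteq> A)"

definition realizes ::
  "('f, 'r, 'm) struct \<Rightarrow> nat list \<Rightarrow> 'm list \<Rightarrow> ('f, 'r, 'm) pfm set \<Rightarrow> bool" where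
  "realizes M xs bs S \<longleftrightarrow> (\<forall>(p, s) \<in> S. sat M (assign s xs bs) p)"

text \<open>Consistency with the elementary diagram of \<open>M\<close>, that is, finite satisfiability in \<open>M\<close>.\<close>

definition consistent ::
  "('f, 'r, 'm) struct \<Rightarrow> nat list \<Rightarrow> ('f, 'r, 'm) pfm set \<Rightarrow> bool" where
  "consistent M xs S \<longleftrightarrow>
     (\<forall>S0. finite S0 \<and> S0 \<subseteq> S \<longrightarrow> (\<exists>bs \<in> tuples M (length xs). realizes M xs bs S0))"

definition saturated :: "('f, 'r) lang \<Rightarrow> 'l rel \<Rightarrow> ('f, 'r, 'm) struct \<Rightarrow> bool" where
  "saturated L lam M \<longleftrightarrow>
     (\<forall>A xs S. A \<subseteq> univ M \<and> |A| <o lam \<and> distinct xs \<and> (\<forall>ps \<in> S. is_pformula L A xs ps) \<and>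
        consistent M xs S \<longrightarrow> (\<exists>bs \<in> tuples M (length xs). realizes M xs bs S))"

definition embedding ::
  "('f, 'r) lang \<Rightarrow> ('f, 'r, 'a) struct \<Rightarrow> ('f, 'r, 'b) struct \<Rightarrow> ('a \<Rightarrow> 'b) \<Rightarrow> bool" where
  "embedding L A B h \<longleftrightarrow> inj_on h (univ A) \<and> h ` univ A \<subseteq> univ B \<and>
     (\<forall>f \<in> fun_symbols L. \<forall>as \<in> tuples A (fun_arity L f).
        h (fun_interp A f as) = fun_interp B f (map h as)) \<and>
     (\<forall>r \<in> rel_symbols L. \<forall>as \<in> tuples A (rel_arity L r).
        rel_interp A r as \<longleftrightarrow> rel_interp B r (map h as))"

definition automorphism :: "('f, 'r) lang \<Rightarrow> ('f, 'r, 'm) struct \<Rightarrow> ('m \<Rightarrow> 'm) \<Rightarrow> bool" where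
  "automorphism L M h \<longleftrightarrow> embedding L M M h \<and> h ` univ M = univ M"

definition partial_elementary ::
  "('f, 'r) lang \<Rightarrow> ('f, 'r, 'm) struct \<Rightarrow> 'm set \<Rightarrow> ('m \<Rightarrow> 'm) \<Rightarrow> bool" where
  "partial_elementary L M A h \<longleftrightarrow> A \<subseteq> univ M \<and> h ` A \<subseteq> univ M \<and>
     (\<forall>p e. is_formula L p \<and> e ` free_vars p \<subseteq> A \<longrightarrow> sat M e p = sat M (h \<circ> e) p)"

definition strongly_homogeneous ::
  "('f, 'r) lang \<Rightarrow> 'l rel \<Rightarrow> ('f, 'r, 'm) struct \<Rightarrow> bool" where
  "strongly_homogeneous L lam M \<longleftrightarrow>
     (\<forall>A h. |A| <o lam \<and> partial_elementary L M A h \<longrightarrow>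
        (\<exists>g. automorphism L M g \<and> (\<forall>x \<in> A. g x = h x)))"

text \<open>
  The cardinal \<open>lam\<close> is the bound below which sets are small; cardinals are represented by
  well-order relations as in the library.
\<close>

definition monster_model ::
  "('f, 'r) lang \<Rightarrow> ('f, 'r) fm set \<Rightarrow> 'l rel \<Rightarrow> ('f, 'r, 'm) struct \<Rightarrow> bool" where
  "monster_model L T lam M \<longleftrightarrow>
     Card_order lam \<and> natLeq <o lam \<and> |fun_symbols L| <o lam \<and> |rel_symbols L| <o lam \<and>
     is_model L T M \<and> saturated L lam M \<and> strongly_homogeneous L lam M"


section \<open>Stability\<close>

definition partitioned_formula ::
  "('f, 'r) lang \<Rightarrow> ('f, 'r) fm \<Rightarrow> nat list \<Rightarrow> nat list \<Rightarrow> bool" where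
  "partitioned_formula L p xs ys \<longleftrightarrow> is_formula L p \<and> distinct (xs @ ys) \<and>
     free_vars p \<subseteq> set (xs @ ys)"

text \<open>The formula with parameters obtained from \<open>p(xs, ys)\<close> by assigning \<open>as\<close> to \<open>ys\<close>.\<close>

definition inst :: "('f, 'r) fm \<Rightarrow> nat list \<Rightarrow> 'm list \<Rightarrow> ('f, 'r, 'm) pfm" where
  "inst p ys as = (p, assign (\<lambda>_. undefined) ys as)"

definition unstable_formula ::
  "('f, 'r, 'm) struct \<Rightarrow> ('f, 'r) fm \<Rightarrow> nat list \<Rightarrow> nat list \<Rightarrow> bool" where
  "unstable_formula M p xs ys \<longleftrightarrow>
     (\<exists>b a. (\<forall>i :: nat. b i \<in> tuples M (length xs)) \<and> (\<forall>j :: nat. a j \<in> tuples M (length ys)) \<and>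
        (\<forall>i j. realizes M xs (b i) {inst p ys (a j)} \<longleftrightarrow> i < j))"

definition unstable_theory :: "('f, 'r) lang \<Rightarrow> ('f, 'r, 'm) struct \<Rightarrow> bool" where
  "unstable_theory L M \<longleftrightarrow>
     (\<exists>p xs ys. partitioned_formula L p xs ys \<and> unstable_formula M p xs ys)"


section \<open>The colored linear order\<close>

text \<open>
  Fraisse limits are needed for relational languages only, where finitely generated substructures
  are the finite ones; finite structures are represented up to isomorphism on subsets of \<open>nat\<close>.
  For an uncountable language the limit may be forced to be uncountable
  (uncountably many colors are), and then its cardinality is left open.
\<close>

definition fraisse_limit ::
  "('f, 'r) lang \<Rightarrow> (('f, 'r, nat) struct \<Rightarrow> bool) \<Rightarrow> ('f, 'r, 'c) struct \<Rightarrow> bool" where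
  "fraisse_limit L K C \<longleftrightarrow> fun_symbols L = {} \<and> is_structure L C \<and>
     (countable (rel_symbols L) \<longrightarrow> countable (univ C)) \<and>
     (\<forall>A. is_structure L A \<and> finite (univ A) \<longrightarrow> (K A \<longleftrightarrow> (\<exists>h. embedding L A C h))) \<and>
     (\<forall>A h. finite A \<and> A \<subseteq> univ C \<and> embedding L (C\<lparr>univ := A\<rparr>) C h \<longrightarrow>
        (\<exists>g. automorphism L C g \<and> (\<forall>x \<in> A. g x = h x)))"

datatype 'k color_symbol = Less | Color 'k

definition color_lang :: "'k set \<Rightarrow> (unit, 'k color_symbol) lang" where
  "color_lang I = \<lparr>fun_symbols = {}, rel_symbols = insert Less (Color ` I), fun_arity = (\<lambda>_. 0),
     rel_arity = (\<lambda>r. case r of Less \<Rightarrow> 2 | Color _ \<Rightarrow> 1)\<rparr>"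

definition colored_linear_order :: "'k set \<Rightarrow> (unit, 'k color_symbol, 'c) struct \<Rightarrow> bool" where
  "colored_linear_order I A \<longleftrightarrow> is_structure (color_lang I) A \<and>
     strict_linear_order_on (univ A)
       {(x, y). x \<in> univ A \<and> y \<in> univ A \<and> rel_interp A Less [x, y]} \<and>
     (\<forall>x \<in> univ A. \<exists>!k. k \<in> I \<and> rel_interp A (Color k) [x])"

text \<open>For a cardinal \<open>kappa\<close> the set of color indices is the underlying set of \<open>kappa\<close>.\<close>

definition is_c :: "'k rel \<Rightarrow> (unit, 'k color_symbol, 'c) struct \<Rightarrow> bool" where
  "is_c kappa C \<longleftrightarrow>
     fraisse_limit (color_lang (Field kappa)) (colored_linear_order (Field kappa)) C"

definition tuple_realizes :: "('f, 'r, 'c) struct \<Rightarrow> 'c list \<Rightarrow> ('f, 'r) fm set \<Rightarrow> bool" where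
  "tuple_realizes C is q \<longleftrightarrow> (\<forall>p \<in> q. sat C (assign (\<lambda>_. undefined) [0..<length is] is) p)"

definition qf_type ::
  "('f, 'r) lang \<Rightarrow> ('f, 'r, 'c) struct \<Rightarrow> 'c list \<Rightarrow> ('f, 'r) fm set" where
  "qf_type L C is = {p. is_formula L p \<and> quantifier_free p \<and> free_vars p \<subseteq> {..<length is} \<and>
     tuple_realizes C is {p}}"

text \<open>
  The complete quantifier-free types are those of the tuples of the structure. For infinitely many
  colors this excludes sets of formulas satisfiable only by uncolored elements; no tuple
  would realize these, and inconsistency along them would be vacuous.
\<close>

definition complete_qf_type ::
  "('f, 'r) lang \<Rightarrow> ('f, 'r, 'c) struct \<Rightarrow> nat \<Rightarrow> ('f, 'r) fm set \<Rightarrow> bool" where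
  "complete_qf_type L C n q \<longleftrightarrow> (\<exists>is \<in> tuples C n. q = qf_type L C is)"


section \<open>The tree property\<close>

definition q_inconsistent ::
  "(unit, 'k color_symbol, 'c) struct \<Rightarrow> nat \<Rightarrow> (unit, 'k color_symbol) fm set \<Rightarrow>
   ('f, 'r, 'm) struct \<Rightarrow> nat list \<Rightarrow> ('c \<Rightarrow> ('f, 'r, 'm) pfm) \<Rightarrow> bool" where
  "q_inconsistent C n q M xs F \<longleftrightarrow>
     (\<forall>is \<in> tuples C n. tuple_realizes C is q \<longrightarrow> \<not> consistent M xs (F ` set is))"

text \<open>
  Nodes of the tree are lists over the universe of \<open>C\<close>, and branches are sequences. The
  restriction of the branch \<open>beta\<close> to \<open>i\<close> is \<open>map beta [0..<i]\<close>.
\<close>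

definition formula_cTP ::
  "'k rel \<Rightarrow> (unit, 'k color_symbol, 'c) struct \<Rightarrow> ('f, 'r, 'm) struct \<Rightarrow>
   ('f, 'r) fm \<Rightarrow> nat list \<Rightarrow> nat list \<Rightarrow> bool" where
  "formula_cTP kappa C M p xs ys \<longleftrightarrow>
     (\<exists>(a :: 'c list \<Rightarrow> 'm list) n q.
        (\<forall>eta \<in> lists (univ C). a eta \<in> tuples M (length ys)) \<and>
        complete_qf_type (color_lang (Field kappa)) C n q \<and>
        (\<forall>beta. range beta \<subseteq> univ C \<longrightarrow>
           consistent M xs {inst p ys (a (map beta [0..<i])) | i. True}) \<and>
        (\<forall>eta \<in> lists (univ C). q_inconsistent C n q M xs (\<lambda>i. inst p ys (a (eta @ [i])))))"

definition theory_cTP ::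
  "('f, 'r) lang \<Rightarrow> 'k rel \<Rightarrow> (unit, 'k color_symbol, 'c) struct \<Rightarrow> ('f, 'r, 'm) struct \<Rightarrow> bool"
where
  "theory_cTP L kappa C M \<longleftrightarrow>
     (\<exists>p xs ys. partitioned_formula L p xs ys \<and> formula_cTP kappa C M p xs ys)"

end

(*
  Let W be the set of entries of a tuple realizing q. For every x and every node eta in W^{<omega},
  phi(x, a_{eta i}) fails for some i in W, so a branch can be chosen diagonally whose realization
  has a phi-type different from those of any given countable list of tuples. Hence there are
  uncountably many phi-types over the countably many parameters a_eta, eta in W^{<omega}. The
  Erdos-Makkai argument then yields b_i and a_j with phi(b_i, a_j) iff i < j, or iff j <= i. A
  sequence of the second kind is turned into one of the first kind by adding elements beyond its
  end in descending order: the type of each new element is approximated by the elements of the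
  given sequence, hence realized by saturation.
*)
theory Submission
  imports Defs "HOL-Library.Ramsey" "HOL-Library.Countable_Set_Type"
begin

section \<open>The Erdos-Makkai theorem\<close>

text \<open>Each such \<open>S\<close> is a union of cells of the partition of \<open>A\<close>
  induced by some finite \<open>G0\<close>, so it is determined by \<open>G0\<close> and the choice
  of cells. For countable \<open>G\<close> there are only countably many such pairs.\<close>

lemma countable_saturated_sets:
  assumes "countable G"
  shows "countable {S. S \<subseteq> A \<and>
    (\<exists>G0. finite G0 \<and> G0 \<subseteq> G \<and>
      (\<forall>a\<in>S. \<forall>b\<in>A - S. \<exists>X\<in>G0. \<not> (a \<in> X \<longleftrightarrow> b \<in> X)))}" (is "countable ?F")
proof -
  \<comment> \<open>A cell is named by the set of members of \<open>G0\<close> that contain its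
    points; \<open>Q\<close> lists the cells that make up the set.\<close>
  let ?f = "\<lambda>(G0, Q). {a \<in> A. {X \<in> G0. a \<in> X} \<in> Q}"
  have "countable (SIGMA G0 : Fpow G. Pow (Pow G0))"
    using assms by (intro countable_SIGMA countable_Fpow) (auto simp: Fpow_def intro: countable_finite)
  moreover have "?F \<subseteq> ?f ` (SIGMA G0 : Fpow G. Pow (Pow G0))"
  proof clarify
    fix S G0
    assume S: "S \<subseteq> A" "finite G0" "G0 \<subseteq> G"
      and sep: "\<forall>a\<in>S. \<forall>b\<in>A - S. \<exists>X\<in>G0. \<not> (a \<in> X \<longleftrightarrow> b \<in> X)"
    have "b \<in> S"
      if "b \<in> A" "a \<in> S" "{X \<in> G0. b \<in> X} = {X \<in> G0. a \<in> X}" for a b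
      using that sep by blast
    then have "S = ?f (G0, (\<lambda>a. {X \<in> G0. a \<in> X}) ` S)"
      using S(1) by auto
    moreover have "(G0, (\<lambda>a. {X \<in> G0. a \<in> X}) ` S) \<in> (SIGMA G0 : Fpow G. Pow (Pow G0))"
      using S(2,3) by (auto simp: Fpow_def)
    ultimately show "S \<in> ?f ` (SIGMA G0 : Fpow G. Pow (Pow G0))"
      by (rule image_eqI)
  qed
  ultimately show ?thesis
    by (meson countable_image countable_subset)
qed

text \<open>For each of the countably many pairs of finite subsets of \<open>A\<close> that some
  member of \<open>F\<close> separates, one such member is chosen. The result is dense in
  \<open>F\<close> for pointwise convergence on \<open>A\<close>.\<close>

lemma countable_approximating_subfamily:
  assumes "countable A"
  obtains G where "countable G" "G \<subseteq> F"
    "\<And>S X Y. S \<in> F \<Longrightarrow> finite X \<Longrightarrow> finite Y \<Longrightarrow> X \<subseteq> A \<Longrightarrow> Y \<subseteq> A \<Longrightarrow> X \<subseteq> S \<Longrightarrow> Y \<inter> S = {} \<Longrightarrow>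
       \<exists>S'\<in>G. X \<subseteq> S' \<and> Y \<inter> S' = {}"
proof -
  let ?ok = "\<lambda>X Y S. S \<in> F \<and> X \<subseteq> S \<and> Y \<inter> S = {}"
  define D where "D = {(X, Y). (X, Y) \<in> Fpow A \<times> Fpow A \<and> (\<exists>S. ?ok X Y S)}"
  define G where "G = (\<lambda>(X, Y). SOME S. ?ok X Y S) ` D"
  have "D \<subseteq> Fpow A \<times> Fpow A"
    by (auto simp: D_def)
  then have "countable D"
    using assms by (meson countable_Fpow countable_SIGMA countable_subset)
  then have "countable G"
    by (simp add: G_def)
  have ok: "?ok X Y (SOME S. ?ok X Y S)" if "(X, Y) \<in> D" for X Y
    using that unfolding D_def by (auto intro!: someI_ex[where P = "?ok X Y"])
  show thesis
  proof
    show "countable G" by fact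
    show "G \<subseteq> F"
      using ok by (auto simp: G_def)
    fix S X Y
    assume "S \<in> F" "finite X" "finite Y" "X \<subseteq> A" "Y \<subseteq> A" "X \<subseteq> S" "Y \<inter> S = {}"
    then have "(X, Y) \<in> D"
      by (auto simp: D_def Fpow_def)
    then show "\<exists>S'\<in>G. X \<subseteq> S' \<and> Y \<inter> S' = {}"
      using ok[of X Y] by (force simp: G_def)
  qed
qed

text \<open>By counting, some \<open>S0\<close> in \<open>F\<close> is not a finite Boolean
  combination of members of the dense subfamily \<open>G\<close>. Pairs of points that
  \<open>S0\<close> separates but finitely many members of \<open>G\<close> do not are collected
  along a sequence, which Ramsey's theorem makes uniform.\<close>

theorem Erdos_Makkai:
  fixes F :: "'a set set"
  assumes "countable A" "F \<subseteq> Pow A" "uncountable F"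
  obtains S a where "range S \<subseteq> F" "range a \<subseteq> A"
    "(\<forall>i j :: nat. a j \<in> S i \<longleftrightarrow> i < j) \<or> (\<forall>i j :: nat. a j \<in> S i \<longleftrightarrow> j \<le> i)"
proof -
  obtain G where G: "countable G" "G \<subseteq> F"
    and approx: "\<And>S X Y. S \<in> F \<Longrightarrow> finite X \<Longrightarrow> finite Y \<Longrightarrow> X \<subseteq> A \<Longrightarrow> Y \<subseteq> A \<Longrightarrow> X \<subseteq> S \<Longrightarrow>
      Y \<inter> S = {} \<Longrightarrow> \<exists>S'\<in>G. X \<subseteq> S' \<and> Y \<inter> S' = {}"
    using countable_approximating_subfamily[OF assms(1)] by metis
  obtain S0 where S0: "S0 \<in> F"
    and insep: "\<And>G0. finite G0 \<Longrightarrow> G0 \<subseteq> G \<Longrightarrow> \<exists>a\<in>S0. \<exists>b\<in>A - S0. \<forall>X\<in>G0. a \<in> X \<longleftrightarrow> b \<in> X"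
  proof -
    let ?N = "{S. S \<subseteq> A \<and> (\<exists>G0. finite G0 \<and> G0 \<subseteq> G \<and>
        (\<forall>a\<in>S. \<forall>b\<in>A - S. \<exists>X\<in>G0. \<not> (a \<in> X \<longleftrightarrow> b \<in> X)))}"
    have "\<not> F \<subseteq> ?N"
      using countable_subset[OF _ countable_saturated_sets[OF G(1), of A]] assms(3) by blast
    then obtain S0 where S0: "S0 \<in> F" "S0 \<notin> ?N"
      by (meson subsetI)
    moreover have "S0 \<subseteq> A"
      using S0(1) assms(2) by blast
    ultimately show thesis
      by (intro that[of S0]) auto
  qed
  have S0A: "S0 \<subseteq> A"
    using S0 assms(2) by blast
  \<comment> \<open>A new triple consists of a point in \<open>S0\<close>, a point outside
    \<open>S0\<close> that no earlier set separates from it, and a set in \<open>G\<close> that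
    agrees with \<open>S0\<close> on all points chosen so far. Primes mark the earlier
    triples.\<close>
  define step where "step f n r \<longleftrightarrow> (case r of (a, b, S) \<Rightarrow>
      a \<in> S0 \<and> b \<in> A - S0 \<and> S \<in> G \<and> a \<in> S \<and> b \<notin> S \<and>
      (\<forall>j<n. case f j of (a', b', S') \<Rightarrow> (a \<in> S' \<longleftrightarrow> b \<in> S') \<and> a' \<in> S \<and> b' \<notin> S))"
    for f and n :: nat and r :: "'a \<times> 'a \<times> 'a set"
  have "\<exists>f. \<forall>n. step f n (f n)"
  proof (rule dependent_wellorder_choice)
    show "step f n r = step g n r" if "\<And>m. m < n \<Longrightarrow> f m = g m" for f g n r
      using that by (simp add: step_def)
  next
    fix n f
    assume prev: "step f m (f m)" if "m < n" for m
    define a b S where "a j = fst (f j)" and "b j = fst (snd (f j))" and "S j = snd (snd (f j))" for j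
    have f: "f j = (a j, b j, S j)" for j
      by (simp add: a_def b_def S_def)
    have mem: "a j \<in> S0" "b j \<in> A - S0" "S j \<in> G" if "j < n" for j
      using prev[OF that] by (auto simp: step_def f)
    have "\<exists>a\<in>S0. \<exists>b\<in>A - S0. \<forall>X\<in>S ` {..<n}. a \<in> X \<longleftrightarrow> b \<in> X"
      using mem(3) by (intro insep) auto
    then obtain a' b' where ab: "a' \<in> S0" "b' \<in> A - S0" "\<forall>X\<in>S ` {..<n}. a' \<in> X \<longleftrightarrow> b' \<in> X"
      by blast
    \<comment> \<open>The pair had to avoid separation by earlier sets only, so the new set can be
      chosen afterwards, by approximating \<open>S0\<close> on finitely many points.\<close>
    have "\<exists>S'\<in>G. insert a' (a ` {..<n}) \<subseteq> S' \<and> insert b' (b ` {..<n}) \<inter> S' = {}"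
      using mem ab S0 S0A by (intro approx[of S0]) auto
    then obtain S' where "S' \<in> G" "insert a' (a ` {..<n}) \<subseteq> S'" "insert b' (b ` {..<n}) \<inter> S' = {}"
      by blast
    then have "step f n (a', b', S')"
      using ab by (auto simp: step_def f)
    then show "\<exists>r. step f n r" ..
  qed
  then obtain f where step: "\<And>n. step f n (f n)"
    by blast
  define a b S where "a j = fst (f j)" and "b j = fst (snd (f j))" and "S j = snd (snd (f j))" for j
  have f: "f j = (a j, b j, S j)" for j
    by (simp add: a_def b_def S_def)
  have mem: "a j \<in> A" "b j \<in> A" "S j \<in> F" for j
    using step[of j] G(2) S0A by (auto simp: step_def f)
  have le: "a j \<in> S i" "b j \<notin> S i" if "j \<le> i" for i j
    using step[of i] that by (auto simp: step_def f le_less)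
  have less: "a j \<in> S i \<longleftrightarrow> b j \<in> S i" if "i < j" for i j
    using step[of j] that by (auto simp: step_def f)
  \<comment> \<open>\<open>Min\<close> and \<open>Max\<close> restore the order of a pair: for
    \<open>i < j\<close> the color of \<open>{i, j}\<close> tells whether \<open>a j\<close> lies in
    \<open>S i\<close>.\<close>
  define col where "col X = (if a (Max X) \<in> S (Min X) then 1 else 0 :: nat)" for X
  have "\<exists>Y t. Y \<subseteq> UNIV \<and> infinite Y \<and> t < 2 \<and> (\<forall>x\<in>Y. \<forall>y\<in>Y. x \<noteq> y \<longrightarrow> col {x, y} = t)"
    by (rule Ramsey2) (auto simp: col_def)
  then obtain Y t where Y: "infinite Y" and hom: "\<forall>x\<in>Y. \<forall>y\<in>Y. x \<noteq> y \<longrightarrow> col {x, y} = t"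
    by (elim exE conjE)
  then obtain r :: "nat \<Rightarrow> nat" where r: "strict_mono r" "\<And>n. r n \<in> Y"
    using infinite_enumerate[OF Y] by blast
  have rless: "r i < r j" if "i < j" for i j
    using r(1) that by (simp add: strict_mono_def)
  have rle: "r i \<le> r j" if "i \<le> j" for i j
    using r(1) that by (simp add: strict_mono_less_eq)
  have col: "(a (r j) \<in> S (r i)) \<longleftrightarrow> t = 1" if "i < j" for i j
    using hom[rule_format, OF r(2)[of i] r(2)[of j]] rless[OF that] by (auto simp: col_def split: if_splits)
  show thesis
  \<comment> \<open>Whenever \<open>j \<le> i\<close>, \<open>S i\<close> contains
    \<open>a j\<close> and omits \<open>b j\<close>. If it contains the later \<open>a j\<close>, it
    contains the later \<open>b j\<close> too, and the points \<open>b\<close> form the strict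
    ladder; otherwise the points \<open>a\<close> form the other one.\<close>
  proof (cases "t = 1")
    case True
    have "b (r j) \<in> S (r i) \<longleftrightarrow> i < j" for i j
      using col[of i j] less[OF rless, of i j] le(2)[OF rle, of j i] True by (cases "i < j") auto
    then show thesis
      using mem by (intro that[of "S \<circ> r" "b \<circ> r"]) auto
  next
    case False
    have "a (r j) \<in> S (r i) \<longleftrightarrow> j \<le> i" for i j
      using col[of i j] le(1)[OF rle, of j i] False by (cases "i < j") simp_all
    then show thesis
      using mem by (intro that[of "S \<circ> r" "a \<circ> r"]) auto
  qed
qed


section \<open>Ladders in saturated relations\<close>

text \<open>This is the instance of saturation for types built from one relation and its negation.
  Keeping the two sorts abstract lets it apply to the converse relation as well.\<close>

definition countably_saturated :: "'u set \<Rightarrow> 'v set \<Rightarrow> ('u \<Rightarrow> 'v \<Rightarrow> bool) \<Rightarrow> bool" where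
  "countably_saturated U V R \<longleftrightarrow>
     (\<forall>X Y. countable X \<and> countable Y \<and> X \<subseteq> V \<and> Y \<subseteq> V \<and>
        (\<forall>X0 Y0. finite X0 \<and> finite Y0 \<and> X0 \<subseteq> X \<and> Y0 \<subseteq> Y \<longrightarrow>
           (\<exists>u\<in>U. (\<forall>v\<in>X0. R u v) \<and> (\<forall>v\<in>Y0. \<not> R u v))) \<longrightarrow>
        (\<exists>u\<in>U. (\<forall>v\<in>X. R u v) \<and> (\<forall>v\<in>Y. \<not> R u v)))"

lemma countably_saturatedD:
  assumes "countably_saturated U V R" "countable X" "countable Y" "X \<subseteq> V" "Y \<subseteq> V"
    and "\<And>X0 Y0. finite X0 \<Longrightarrow> finite Y0 \<Longrightarrow> X0 \<subseteq> X \<Longrightarrow> Y0 \<subseteq> Y \<Longrightarrow>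
           \<exists>u\<in>U. (\<forall>v\<in>X0. R u v) \<and> (\<forall>v\<in>Y0. \<not> R u v)"
  obtains u where "u \<in> U" "\<And>v. v \<in> X \<Longrightarrow> R u v" "\<And>v. v \<in> Y \<Longrightarrow> \<not> R u v"
proof -
  have "\<exists>u\<in>U. (\<forall>v\<in>X. R u v) \<and> (\<forall>v\<in>Y. \<not> R u v)"
    using assms(1)[unfolded countably_saturated_def, rule_format, of X Y] assms(2-) by simp
  then show thesis
    using that by blast
qed

lemma finite_subset_range_bound:
  fixes f :: "nat \<Rightarrow> 'a"
  assumes "finite X" "X \<subseteq> range f"
  obtains N where "X \<subseteq> f ` {..<N}"
proof -
  obtain J where "finite J" "X = f ` J"
    using finite_subset_image[OF assms] by blast
  then show thesis
    using that finite_nat_iff_bounded by (metis image_mono)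
qed

text \<open>Read \<open>R b a\<close> as "\<open>a\<close> precedes \<open>b\<close>": the given
  points are ordered \<open>a0 0, b0 0, a0 1, b0 1, ...\<close>. Saturation supplies new points
  beyond all of these, each new pair before the pairs added earlier, so that the indices of the new
  points run against the order.\<close>

lemma ladder_reverse:
  fixes b0 :: "nat \<Rightarrow> 'u" and a0 :: "nat \<Rightarrow> 'v"
  assumes satU: "countably_saturated U V R" and satV: "countably_saturated V U (\<lambda>v u. R u v)"
    and mem: "range b0 \<subseteq> U" "range a0 \<subseteq> V" and lad: "\<And>i j. R (b0 i) (a0 j) \<longleftrightarrow> j \<le> i"
  obtains b a where "range b \<subseteq> U" "range a \<subseteq> V" "\<And>i j :: nat. R (b i) (a j) \<longleftrightarrow> i < j"
proof -
  define step where "step f n r \<longleftrightarrow> (case r of (b, a) \<Rightarrow>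
      b \<in> U \<and> a \<in> V \<and> R b a \<and> (\<forall>i. R b (a0 i)) \<and> (\<forall>i. \<not> R (b0 i) a) \<and>
      (\<forall>j<n. case f j of (b', a') \<Rightarrow> \<not> R b a' \<and> R b' a))"
    for f and n :: nat and r :: "'u \<times> 'v"
  have "\<exists>f. \<forall>n. step f n (f n)"
  proof (rule dependent_wellorder_choice)
    show "step f n r = step g n r" if "\<And>m. m < n \<Longrightarrow> f m = g m" for f g n r
      using that by (simp add: step_def)
  next
    fix n f
    assume prev: "step f m (f m)" if "m < n" for m
    define b a where "b j = fst (f j)" and "a j = snd (f j)" for j
    have f: "f j = (b j, a j)" for j
      by (simp add: a_def b_def)
    have mem': "b j \<in> U" "a j \<in> V" "R (b j) (a0 i)" "\<not> R (b0 i) (a j)" if "j < n" for i j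
      using prev[OF that] by (auto simp: step_def f)
    obtain b' where b': "b' \<in> U" "\<And>v. v \<in> range a0 \<Longrightarrow> R b' v" "\<And>v. v \<in> a ` {..<n} \<Longrightarrow> \<not> R b' v"
    proof (rule countably_saturatedD[OF satU])
      fix X0 Y0
      assume "finite X0" "X0 \<subseteq> range a0" and Y0: "Y0 \<subseteq> a ` {..<n}"
      then obtain N where "X0 \<subseteq> a0 ` {..<N}"
        using finite_subset_range_bound by metis
      \<comment> \<open>\<open>b0 N\<close> lies beyond the first \<open>N\<close> points of
        \<open>a0\<close> and, by the invariant, before every added \<open>a\<close>.\<close>
      then have "(\<forall>v\<in>X0. R (b0 N) v) \<and> (\<forall>v\<in>Y0. \<not> R (b0 N) v)"
        using Y0 mem'(4) by (auto simp: lad subset_iff image_iff Bex_def)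
      then show "\<exists>u\<in>U. (\<forall>v\<in>X0. R u v) \<and> (\<forall>v\<in>Y0. \<not> R u v)"
        using mem(1) by blast
    qed (use mem mem' in auto)
    let ?X = "insert b' (b ` {..<n})"
    obtain a' where "a' \<in> V" "\<And>u. u \<in> ?X \<Longrightarrow> R u a'" "\<And>u. u \<in> range b0 \<Longrightarrow> \<not> R u a'"
    proof (rule countably_saturatedD[OF satV])
      fix X0 Y0
      assume "finite Y0" "Y0 \<subseteq> range b0" and X0: "X0 \<subseteq> ?X"
      then obtain N where "Y0 \<subseteq> b0 ` {..<N}"
        using finite_subset_range_bound by metis
      \<comment> \<open>Dually, \<open>a0 N\<close> lies beyond the first \<open>N\<close> points of
        \<open>b0\<close> and before every added \<open>b\<close>, the new \<open>b'\<close>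
        included.\<close>
      then have "(\<forall>u\<in>X0. R u (a0 N)) \<and> (\<forall>u\<in>Y0. \<not> R u (a0 N))"
        using X0 mem'(3) b'(2)[OF rangeI] by (auto simp: lad subset_iff image_iff Bex_def)
      then show "\<exists>v\<in>V. (\<forall>u\<in>X0. R u v) \<and> (\<forall>u\<in>Y0. \<not> R u v)"
        using mem(2) by blast
    qed (use mem mem' b' in auto)
    then have "step f n (b', a')"
      using b' by (auto simp: step_def f)
    then show "\<exists>r. step f n r" ..
  qed
  then obtain f where step: "\<And>n. step f n (f n)"
    by blast
  define b a where "b j = fst (f j)" and "a j = snd (f j)" for j
  have f: "f j = (b j, a j)" for j
    by (simp add: a_def b_def)
  have mem: "b j \<in> U" "a j \<in> V" for j
    using step[of j] by (auto simp: step_def f)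
  have "R (b i) (a j) \<longleftrightarrow> i \<le> j" for i j
    using step[of i] step[of j] by (cases i j rule: linorder_cases) (auto simp: step_def f)
  \<comment> \<open>Dropping the first \<open>b\<close> turns \<open>i \<le> j\<close> into
    \<open>i < j\<close>.\<close>
  then show thesis
    using that[of "\<lambda>i. b (Suc i)" a] mem by (auto simp: Suc_le_eq)
qed

text \<open>The traces of \<open>R\<close> on \<open>A\<close> are the types over \<open>A\<close>,
  and \<open>Erdos_Makkai\<close> applies to them. A ladder of the wrong orientation is turned
  around by \<open>ladder_reverse\<close>.\<close>

lemma ladder_of_uncountably_many_types:
  assumes satU: "countably_saturated U V R" and satV: "countably_saturated V U (\<lambda>v u. R u v)"
    and "countable A" "A \<subseteq> V" "uncountable ((\<lambda>u. {v \<in> A. R u v}) ` U)"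
  obtains b a where "range b \<subseteq> U" "range a \<subseteq> V" "\<And>i j :: nat. R (b i) (a j) \<longleftrightarrow> i < j"
proof -
  obtain S a where S: "range S \<subseteq> (\<lambda>u. {v \<in> A. R u v}) ` U" and a: "range a \<subseteq> A"
    and lad: "(\<forall>i j :: nat. a j \<in> S i \<longleftrightarrow> i < j) \<or> (\<forall>i j :: nat. a j \<in> S i \<longleftrightarrow> j \<le> i)"
    using Erdos_Makkai[of A "(\<lambda>u. {v \<in> A. R u v}) ` U"] assms(3,5) by auto
  have "\<forall>i. \<exists>u. u \<in> U \<and> S i = {v \<in> A. R u v}"
    using S by blast
  then obtain b where b: "\<And>i. b i \<in> U" "\<And>i. S i = {v \<in> A. R (b i) v}"
    by metis
  have "R (b i) (a j) \<longleftrightarrow> a j \<in> S i" for i j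
    using a b(2) by auto
  then consider "\<forall>i j. R (b i) (a j) \<longleftrightarrow> i < j" | "\<forall>i j. R (b i) (a j) \<longleftrightarrow> j \<le> i"
    using lad by auto
  then show thesis
  proof cases
    case 1
    then show thesis
      using that[of b a] b(1) a assms(4) by blast
  next
    case 2
    then show thesis
      using ladder_reverse[OF satU satV, of b a] that b(1) a assms(4) by blast
  qed
qed

text \<open>Diagonalization: given a sequence of types, each node has a successor that refutes the
  next one, so some branch refutes them all, and yet an element of \<open>U\<close> realizes
  it.\<close>

lemma uncountably_many_branch_types:
  assumes "U \<noteq> {}"
    and branch: "\<And>beta. range beta \<subseteq> W \<Longrightarrow> \<exists>u\<in>U. \<forall>i. R u (a (map beta [0..<i]))"
    and node: "\<And>eta u. eta \<in> lists W \<Longrightarrow> u \<in> U \<Longrightarrow> \<exists>w\<in>W. \<not> R u (a (eta @ [w]))"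
  shows "uncountable ((\<lambda>u. {v \<in> a ` lists W. R u v}) ` U)"
proof
  let ?t = "\<lambda>u. {v \<in> a ` lists W. R u v}"
  assume "countable (?t ` U)"
  then have enum: "range (from_nat_into (?t ` U)) = ?t ` U"
    using assms(1) by (intro range_from_nat_into) auto
  \<comment> \<open>\<open>u k\<close> represents the \<open>k\<close>-th type of the
    enumeration.\<close>
  define u where "u k = inv_into U ?t (from_nat_into (?t ` U) k)" for k
  have "from_nat_into (?t ` U) k \<in> ?t ` U" for k
    using enum by blast
  then have u: "u k \<in> U" "from_nat_into (?t ` U) k = ?t (u k)" for k
    unfolding u_def by (rule inv_into_into, rule f_inv_into_f[symmetric])
  obtain w where w: "\<And>eta v. eta \<in> lists W \<Longrightarrow> v \<in> U \<Longrightarrow> w eta v \<in> W \<and> \<not> R v (a (eta @ [w eta v]))"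
    using node by metis
  \<comment> \<open>The step from level \<open>k\<close> goes to a successor at which
    \<open>R\<close> fails for \<open>u k\<close>.\<close>
  define eta where "eta = rec_nat [] (\<lambda>k e. e @ [w e (u k)])"
  have eta: "eta 0 = []" "eta (Suc k) = eta k @ [w (eta k) (u k)]" for k
    by (simp_all add: eta_def)
  have etaW: "eta k \<in> lists W" for k
    using w u(1) by (induction k) (auto simp: eta)
  define beta where "beta k = w (eta k) (u k)" for k
  have map_beta: "map beta [0..<k] = eta k" for k
    by (induction k) (auto simp: eta beta_def)
  have "range beta \<subseteq> W"
    using w[OF etaW u(1)] by (auto simp: beta_def)
  then obtain b where b: "b \<in> U" "\<And>i. R b (a (eta i))"
    using branch[of beta] map_beta by auto
  have "?t b \<in> range (from_nat_into (?t ` U))"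
    using b(1) enum by blast
  then obtain k where "?t b = ?t (u k)"
    using u(2) by auto
  moreover have "a (eta (Suc k)) \<in> ?t b"
    using b(2) etaW by blast
  ultimately have "R (u k) (a (eta (Suc k)))"
    by blast
  then show False
    using w[OF etaW u(1)] by (simp add: eta)
qed


section \<open>Types in the monster model\<close>

lemma assign_in_set:
  assumes "length xs = length as" "v \<in> set xs"
  shows "assign e xs as v \<in> set as"
proof -
  obtain d where "map_of (zip xs as) v = Some d"
    using assms by (metis map_of_zip_is_Some)
  then show ?thesis
    using map_of_SomeD set_zip_rightD by (fastforce simp: assign_def)
qed

lemma assign_notin: "length xs = length as \<Longrightarrow> v \<notin> set xs \<Longrightarrow> assign e xs as v = e v"
  by (auto simp: assign_def split: option.split dest: map_of_SomeD set_zip_leftD)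

lemma assign_in_indep:
  "length xs = length as \<Longrightarrow> v \<in> set xs \<Longrightarrow> assign e xs as v = assign e' xs as v"
  by (metis assign_def map_of_zip_is_Some option.simps(5))

lemma assign_commute:
  assumes "length xs = length bs" "length ys = length as" "set xs \<inter> set ys = {}"
  shows "assign (assign e ys as) xs bs = assign (assign e xs bs) ys as"
proof
  fix v
  show "assign (assign e ys as) xs bs v = assign (assign e xs bs) ys as v"
    using assms assign_notin[of xs bs v] assign_notin[of ys as v]
      assign_in_indep[of xs bs v] assign_in_indep[of ys as v]
    by (cases "v \<in> set xs"; cases "v \<in> set ys") (auto 4 3)
qed

text \<open>This views the formula as a binary relation between tuples, the form in which the ladder
  results apply.\<close>

definition holds ::
  "('f, 'r, 'm) struct \<Rightarrow> ('f, 'r) fm \<Rightarrow> nat list \<Rightarrow> nat list \<Rightarrow> 'm list \<Rightarrow> 'm list \<Rightarrow> bool" where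
  "holds M p xs ys bs as \<longleftrightarrow> realizes M xs bs {inst p ys as}"

lemma holds_iff_sat: "holds M p xs ys bs as \<longleftrightarrow> sat M (assign (assign (\<lambda>_. undefined) ys as) xs bs) p"
  by (simp add: holds_def realizes_def inst_def)

text \<open>As \<open>xs\<close> and \<open>ys\<close> are disjoint, the two assignments
  commute.\<close>

lemma holds_swap:
  assumes "partitioned_formula L p xs ys" "bs \<in> tuples M (length xs)" "as \<in> tuples M (length ys)"
  shows "holds M p xs ys bs as \<longleftrightarrow> holds M p ys xs as bs"
  using assms assign_commute[of xs bs ys as]
  by (simp add: holds_iff_sat partitioned_formula_def tuples_def)

lemma partitioned_formula_swap: "partitioned_formula L p xs ys \<Longrightarrow> partitioned_formula L p ys xs"
  by (auto simp: partitioned_formula_def)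

text \<open>The conditions form a partial type over the set of all entries of the tuples in
  \<open>X\<close> and \<open>Y\<close>. A countable union of finite sets, it has cardinality below
  \<open>lam\<close>.\<close>

lemma saturated_imp_countably_saturated:
  assumes sat: "saturated L lam M" and "natLeq <o lam" and pf: "partitioned_formula L p xs ys"
  shows "countably_saturated (tuples M (length xs)) (tuples M (length ys)) (holds M p xs ys)"
  unfolding countably_saturated_def
proof (intro allI impI, elim conjE)
  fix X Y
  assume XY: "countable X" "countable Y" "X \<subseteq> tuples M (length ys)" "Y \<subseteq> tuples M (length ys)"
    and fin: "\<forall>X0 Y0. finite X0 \<and> finite Y0 \<and> X0 \<subseteq> X \<and> Y0 \<subseteq> Y \<longrightarrow>
      (\<exists>u\<in>tuples M (length xs). (\<forall>v\<in>X0. holds M p xs ys u v) \<and> (\<forall>v\<in>Y0. \<not> holds M p xs ys u v))"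
  define A where "A = (\<Union>as\<in>X \<union> Y. set as)"
  let ?pos = "inst p ys" and ?neg = "inst (Neg p) ys"
  let ?S = "?pos ` X \<union> ?neg ` Y"
  have realizes_iff: "realizes M xs bs (?pos ` X0 \<union> ?neg ` Y0) \<longleftrightarrow>
      (\<forall>v\<in>X0. holds M p xs ys bs v) \<and> (\<forall>v\<in>Y0. \<not> holds M p xs ys bs v)" for bs X0 Y0
    by (simp add: realizes_def holds_iff_sat inst_def ball_Un)
  have "is_pformula L A xs (inst p' ys as)"
    if "p' = p \<or> p' = Neg p" "as \<in> X \<union> Y" for p' as
  proof -
    have "length ys = length as"
      using that(2) XY(3,4) by (auto simp: tuples_def)
    \<comment> \<open>The default \<open>undefined\<close> could lie outside \<open>A\<close>, but
      the free variables of \<open>p\<close> outside \<open>xs\<close> belong to \<open>ys\<close>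
      and receive entries of \<open>as\<close>.\<close>
    have "assign (\<lambda>_. undefined) ys as v \<in> A" if "v \<in> free_vars p - set xs" for v
    proof -
      have "v \<in> set ys"
        using that pf by (auto simp: partitioned_formula_def)
      then have "assign (\<lambda>_. undefined) ys as v \<in> set as"
        by (rule assign_in_set[OF \<open>length ys = length as\<close>])
      then show ?thesis
        using \<open>as \<in> X \<union> Y\<close> by (auto simp: A_def)
    qed
    then show ?thesis
      using that(1) pf by (auto simp: is_pformula_def inst_def partitioned_formula_def)
  qed
  then have pform: "\<forall>ps\<in>?S. is_pformula L A xs ps"
    by (auto simp: Ball_def)
  have "countable A"
    unfolding A_def using XY(1,2) by (intro countable_UN) (auto intro: countable_finite)
  then have "|A| <o lam"
    using assms(2) countable_card_le_natLeq ordLeq_ordLess_trans by blast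
  moreover have "A \<subseteq> univ M"
    using XY(3,4) by (auto simp: A_def tuples_def)
  moreover have "distinct xs"
    using pf by (simp add: partitioned_formula_def)
  moreover note pform
  moreover have "consistent M xs ?S"
    unfolding consistent_def
  proof (intro allI impI, elim conjE)
    fix S0
    assume "finite S0" "S0 \<subseteq> ?S"
    then have "finite (S0 \<inter> ?pos ` X)" "finite (S0 \<inter> ?neg ` Y)"
      by auto
    then obtain X0 Y0 where X0: "finite X0" "finite Y0" "X0 \<subseteq> X" "Y0 \<subseteq> Y"
      and eqs: "S0 \<inter> ?pos ` X = ?pos ` X0" "S0 \<inter> ?neg ` Y = ?neg ` Y0"
      by (meson Int_lower2 finite_subset_image)
    have "S0 = (S0 \<inter> ?pos ` X) \<union> (S0 \<inter> ?neg ` Y)"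
      using \<open>S0 \<subseteq> ?S\<close> by (simp only: Int_Un_distrib[symmetric] Int_absorb2)
    also have "\<dots> = ?pos ` X0 \<union> ?neg ` Y0"
      by (simp only: eqs)
    finally show "\<exists>bs\<in>tuples M (length xs). realizes M xs bs S0"
      using fin X0 by (simp add: realizes_iff)
  qed
  ultimately have "\<exists>bs\<in>tuples M (length xs). realizes M xs bs ?S"
    by (intro sat[unfolded saturated_def, rule_format] conjI) auto
  then show "\<exists>u\<in>tuples M (length xs).
      (\<forall>v\<in>X. holds M p xs ys u v) \<and> (\<forall>v\<in>Y. \<not> holds M p xs ys u v)"
    by (simp add: realizes_iff)
qed

text \<open>Exchanging the variable lists reduces this to the previous case. The two relations are
  known to agree only on tuples of the right lengths, so the conditions are translated one by
  one.\<close>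

lemma saturated_imp_countably_saturated_swap:
  assumes "saturated L lam M" "natLeq <o lam" "partitioned_formula L p xs ys"
  shows "countably_saturated (tuples M (length ys)) (tuples M (length xs))
           (\<lambda>as bs. holds M p xs ys bs as)"
proof -
  have eq: "holds M p ys xs as bs \<longleftrightarrow> holds M p xs ys bs as"
    if "as \<in> tuples M (length ys)" "bs \<in> tuples M (length xs)" for as bs
    using holds_swap[OF assms(3) that(2,1)] by (rule sym)
  note sat = saturated_imp_countably_saturated[OF assms(1,2) partitioned_formula_swap[OF assms(3)]]
  show ?thesis
    unfolding countably_saturated_def
  proof (intro allI impI, elim conjE)
    fix X Y
    assume XY: "countable X" "countable Y" "X \<subseteq> tuples M (length xs)" "Y \<subseteq> tuples M (length xs)"
      and fin: "\<forall>X0 Y0. finite X0 \<and> finite Y0 \<and> X0 \<subseteq> X \<and> Y0 \<subseteq> Y \<longrightarrow>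
        (\<exists>u\<in>tuples M (length ys). (\<forall>v\<in>X0. holds M p xs ys v u) \<and> (\<forall>v\<in>Y0. \<not> holds M p xs ys v u))"
    obtain u where "u \<in> tuples M (length ys)"
      "\<And>v. v \<in> X \<Longrightarrow> holds M p ys xs u v" "\<And>v. v \<in> Y \<Longrightarrow> \<not> holds M p ys xs u v"
    proof (rule countably_saturatedD[OF sat XY])
      fix X0 Y0
      assume X0: "finite X0" "finite Y0" "X0 \<subseteq> X" "Y0 \<subseteq> Y"
      then obtain u where "u \<in> tuples M (length ys)"
        "\<forall>v\<in>X0. holds M p xs ys v u" "\<forall>v\<in>Y0. \<not> holds M p xs ys v u"
        using fin by blast
      then show "\<exists>u\<in>tuples M (length ys).
          (\<forall>v\<in>X0. holds M p ys xs u v) \<and> (\<forall>v\<in>Y0. \<not> holds M p ys xs u v)"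
        using eq X0(3,4) XY(3,4) by (intro bexI[of _ u]) (simp_all add: subset_iff)
    qed blast
    then show "\<exists>u\<in>tuples M (length ys).
        (\<forall>v\<in>X. holds M p xs ys v u) \<and> (\<forall>v\<in>Y. \<not> holds M p xs ys v u)"
      using eq XY(3,4) by (intro bexI[of _ u]) (simp_all add: subset_iff)
  qed
qed

text \<open>A tuple satisfying every member of the family would realize each of its finite
  parts.\<close>

lemma not_consistent_realizes:
  assumes "\<not> consistent M xs (F ` W)" "bs \<in> tuples M (length xs)"
  shows "\<exists>w\<in>W. \<not> realizes M xs bs {F w}"
proof -
  obtain S0 where "S0 \<subseteq> F ` W" "\<not> realizes M xs bs S0"
    using assms by (auto simp: consistent_def)
  then obtain ps where "ps \<in> S0" "\<not> realizes M xs bs {ps}"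
    by (auto simp: realizes_def)
  then show ?thesis
    using \<open>S0 \<subseteq> F ` W\<close> by blast
qed

text \<open>Restricting the tree to the entries of one realization of \<open>q\<close> leaves
  countably many nodes, while the instances at the successors of each node remain jointly
  inconsistent. Diagonalization then gives uncountably many types over countably many
  parameters.\<close>

lemma unstable_formula_if_formula_cTP:
  fixes M :: "('f, 'r, 'm) struct"
  assumes sat: "saturated L lam M" and lam: "natLeq <o lam" and ne: "univ M \<noteq> {}"
    and pf: "partitioned_formula L p xs ys" and cTP: "formula_cTP kappa C M p xs ys"
  shows "unstable_formula M p xs ys"
proof -
  let ?U = "tuples M (length xs)" and ?V = "tuples M (length ys)" and ?R = "holds M p xs ys"
  note satU = saturated_imp_countably_saturated[OF sat lam pf]
    and satV = saturated_imp_countably_saturated_swap[OF sat lam pf]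
  obtain a n q where a: "\<forall>eta \<in> lists (univ C). a eta \<in> ?V"
    and q: "complete_qf_type (color_lang (Field kappa)) C n q"
    and branch: "\<And>beta. range beta \<subseteq> univ C \<Longrightarrow>
      consistent M xs {inst p ys (a (map beta [0..<i])) | i. True}"
    and node: "\<And>eta. eta \<in> lists (univ C) \<Longrightarrow>
      q_inconsistent C n q M xs (\<lambda>i. inst p ys (a (eta @ [i])))"
    using cTP unfolding formula_cTP_def by blast
  \<comment> \<open>A complete type is by definition the type of a tuple of \<open>C\<close>, and
    that tuple realizes it.\<close>
  obtain ws where ws: "ws \<in> tuples C n" "tuple_realizes C ws q"
    using q by (force simp: complete_qf_type_def qf_type_def tuple_realizes_def)
  define W where "W = set ws"
  have W: "W \<subseteq> univ C" "lists W \<subseteq> lists (univ C)"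
    using ws(1) by (auto simp: W_def tuples_def)
  have aV: "a ` lists W \<subseteq> ?V"
    using a W(2) by blast
  have unc: "uncountable ((\<lambda>u. {v \<in> a ` lists W. ?R u v}) ` ?U)"
  proof (rule uncountably_many_branch_types)
    obtain m where "m \<in> univ M"
      using ne by blast
    then have "replicate (length xs) m \<in> ?U"
      by (auto simp: tuples_def)
    then show "?U \<noteq> {}" by blast
  next
    fix beta :: "nat \<Rightarrow> _"
    assume beta: "range beta \<subseteq> W"
    let ?b = "\<lambda>i. a (map beta [0..<i])"
    have bV: "range ?b \<subseteq> ?V"
      using aV beta by (auto simp: image_subset_iff in_lists_conv_set)
    \<comment> \<open>Consistency of the branch is only finite satisfiability; saturation, with no
      negative conditions, realizes all of it at once.\<close>
    obtain u where "u \<in> ?U" "\<And>v. v \<in> range ?b \<Longrightarrow> ?R u v"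
    proof (rule countably_saturatedD[OF satU, of "range ?b" "{}"])
      fix X0 Y0 :: "'m list set"
      assume X0: "finite X0" "X0 \<subseteq> range ?b" "Y0 \<subseteq> {}"
      then have "finite (inst p ys ` X0)"
        "inst p ys ` X0 \<subseteq> {inst p ys (a (map beta [0..<i])) | i. True}"
        by auto
      then obtain u where "u \<in> ?U" "realizes M xs u (inst p ys ` X0)"
        using branch[of beta] beta W(1) unfolding consistent_def by blast
      then show "\<exists>u\<in>?U. (\<forall>v\<in>X0. ?R u v) \<and> (\<forall>v\<in>Y0. \<not> ?R u v)"
        using X0(3) by (auto simp: realizes_def holds_def)
    qed (use bV in auto)
    then show "\<exists>u\<in>?U. \<forall>i. ?R u (?b i)"
      by blast
  next
    fix eta u
    assume "eta \<in> lists W" "u \<in> ?U"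
    then show "\<exists>w\<in>W. \<not> ?R u (a (eta @ [w]))"
      using node[of eta] ws W(2) not_consistent_realizes[of M xs _ W u]
      unfolding q_inconsistent_def holds_def W_def by blast
  qed
  \<comment> \<open>There are countably many finite sequences over the finite set \<open>W\<close>,
    whatever the size of \<open>univ C\<close>.\<close>
  have cnt: "countable (a ` lists W)"
    by (simp add: W_def countable_finite)
  obtain b c where "range b \<subseteq> ?U" "range c \<subseteq> ?V" "\<And>i j :: nat. ?R (b i) (c j) \<longleftrightarrow> i < j"
    by (rule ladder_of_uncountably_many_types[OF satU satV cnt aV unc]) blast
  then show ?thesis
    unfolding unstable_formula_def holds_def by (intro exI[of _ b] exI[of _ c]) auto
qed

theorem theorem5p10:
  fixes L :: "('f, 'r) lang" and T :: "('f, 'r) fm set"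
    and lam :: "'l rel" and M :: "('f, 'r, 'm) struct"
    and kappa :: "'k rel" and C :: "(unit, 'k color_symbol, 'c) struct"
  assumes "complete_theory L T" and "has_infinite_model L T"
    and "Card_order kappa" and "ctwo \<le>o kappa" and "is_c kappa C"
    and "monster_model L T lam M" and "|univ C| <o lam"
  shows "(theory_cTP L kappa C M \<longrightarrow> unstable_theory L M) \<and>
    (\<forall>p xs ys. partitioned_formula L p xs ys \<and> formula_cTP kappa C M p xs ys
       \<longrightarrow> unstable_formula M p xs ys)"
proof -
  have "saturated L lam M" "natLeq <o lam" "univ M \<noteq> {}"
    using assms(6) by (auto simp: monster_model_def is_model_def is_structure_def)
  then have "\<forall>p xs ys. partitioned_formula L p xs ys \<and> formula_cTP kappa C M p xs ys
       \<longrightarrow> unstable_formula M p xs ys"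
    using unstable_formula_if_formula_cTP by blast
  \<comment> \<open>A formula witnessing the tree property of the theory is itself the unstable
    formula required.\<close>
  then show ?thesis
    unfolding theory_cTP_def unstable_theory_def by blast
qed

end
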